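(* Let $(U,g)$ be a metric structure, and let $\star$ and $\underset{g}{\star}$ be the standard and metric Hodge extensor fields on $U$. For all $X\in\mathcal{M}(U)$, $$\star^{-1}(\partial_o\wedge(\star X))=-\partial_o\lrcorner\widehat{X},$$ $$\underset{g}{\star}^{-1}(\partial_o\wedge(\underset{g}{\star}X))=-\frac{1}{\sqrt{|\det[g]|}}\,\underline{g}\Bigl(\partial_o\lrcorner\bigl(\sqrt{|\det[g]|}\,\underline{g}^{-1}(\widehat{X})\bigr)\Bigr).$$
   Context: $M$ is an $n$-dimensional smooth manifold, $(U_o,\phi_o)$ a chart with coordinates $x^1,\dots,x^n$, and $U\subset U_o$ open. The canonical space $\mathcal{U}_o$ is an $n$-dimensional real vector space with basis $b_1,\dots,b_n$ and the Euclidean scalar product $b_\mu\cdot b_\nu=\delta_{\mu\nu}$, extended to $\bigwedge\mathcal{U}_o$ by $(v_1\wedge\dots\wedge v_k)\cdot(w_1\wedge\dots\wedge w_k)=\det(v_i\cdot w_j)$, different grades being orthogonal. $\mathcal{M}(U)$ denotes the smooth maps $U\to\bigwedge\mathcal{U}_o$. On grade $k$: $\widehat X=(-1)^kX$, $\widetilde X=(-1)^{k(k-1)/2}X$. Left contraction: $(X\lrcorner Y)\cdot Z=Y\cdot(\widetilde X\wedge Z)$ for all $Z$. $\partial_o\lrcorner X=\sum_\mu b_\mu\lrcorner\partial X/\partial x^\mu$, $\partial_o\wedge X=\sum_\mu b_\mu\wedge\partial X/\partial x^\mu$. Metric structure $(U,g)$: $g$ is a smooth field of endomorphisms of $\mathcal{U}_o$,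 symmetric for the Euclidean product, with $\det[g]\ne0$ everywhere; $\underline g$ is its exterior-algebra extension and $\underline g^{-1}=\underline{(g^{-1})}$. Standard volume pseudoscalar field: for a pair of reciprocal frame fields $(\{e_\mu\},\{e^\mu\})$ on $U$, $\tau=\sqrt{e_\wedge\cdot e_\wedge}\;e^\wedge$, where $e_\wedge=e_1\wedge\dots\wedge e_n$, $e^\wedge=e^1\wedge\dots\wedge e^n$ (so $\tau=\pm b_1\wedge\dots\wedge b_n$). Standard Hodge extensor field: $\star X=\widetilde X\lrcorner\tau$. Metric Hodge extensor field: $\underset{g}{\star}X=\sqrt{|\det[g]|}\;\underline{g}^{-1}(\widetilde X)\lrcorner\tau$. Both are invertible. *)

theory Defs
  imports "HOL-Analysis.Analysis"
begin

section \<open>The exterior algebra of the canonical space\<close>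

text \<open>
  The canonical space is \<open>real ^ 'n\<close> with its standard basis \<open>b i = axis i 1\<close>, the indices
  \<open>1, \<dots>, n\<close> being the elements of the finite linear order \<open>'n\<close>.  A multivector is given by
  its coefficients with respect to the basis blades
  \<open>b A = b i\<^sub>1 \<and> \<dots> \<and> b i\<^sub>k\<close>, where \<open>A = {i\<^sub>1 < \<dots> < i\<^sub>k}\<close>.  The Euclidean
  inner product of \<open>real ^ 'n set\<close> makes these blades orthonormal; lemma
  \<open>inner_wedge_list\<close> shows that it is the scalar product given by determinants.
\<close>

type_synonym 'n multivector = "(real, 'n set) vec"

definition blade_sign :: "'n::linorder set \<Rightarrow> 'n set \<Rightarrow> real" where
  "blade_sign A B = (-1) ^ card {(a, b). a \<in> A \<and> b \<in> B \<and> b < a}"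

definition wedge :: "'n::{finite,linorder} multivector \<Rightarrow> 'n multivector \<Rightarrow> 'n multivector"
    (infixr \<open>\<curlywedge>\<close> 72) where
  "X \<curlywedge> Y = (\<chi> C. \<Sum>A\<in>Pow C. blade_sign A (C - A) * X $ A * Y $ (C - A))"

definition vec_mv :: "real ^ 'n::finite \<Rightarrow> 'n multivector" where
  "vec_mv v = (\<Sum>i\<in>UNIV. v $ i *\<^sub>R axis {i} 1)"

definition wedge_list :: "(real ^ 'n::{finite,linorder}) list \<Rightarrow> 'n multivector" where
  "wedge_list vs = foldr (\<lambda>v Y. vec_mv v \<curlywedge> Y) vs (axis {} 1)"

definition grade_inv :: "'n::finite multivector \<Rightarrow> 'n multivector" where
  "grade_inv X = (\<chi> A. (-1) ^ card A * X $ A)"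

definition mv_rev :: "'n::finite multivector \<Rightarrow> 'n multivector" where
  "mv_rev X = (\<chi> A. (-1) ^ (card A * (card A - 1) div 2) * X $ A)"

definition lcontr :: "'n::{finite,linorder} multivector \<Rightarrow> 'n multivector \<Rightarrow> 'n multivector" where
  "lcontr X Y = (THE W. \<forall>Z. W \<bullet> Z = Y \<bullet> (mv_rev X \<curlywedge> Z))"

definition ext_map :: "((real, 'n::{finite,linorder}) vec \<Rightarrow> (real, 'n) vec) \<Rightarrow> 'n multivector \<Rightarrow> 'n multivector" where
  "ext_map f X = (\<Sum>A\<in>UNIV. X $ A *\<^sub>R wedge_list (map (\<lambda>i. f (axis i 1)) (sorted_list_of_set A)))"


subsection \<open>The characteristic properties of these operations\<close>

lemma bilinear_wedge: "bilinear (\<curlywedge>)"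
  unfolding bilinear_def
  by (auto intro!: linearI simp: wedge_def vec_eq_iff algebra_simps sum.distrib sum_distrib_left)

lemmas wedge_bilinear_simps =
  bilinear_ladd[OF bilinear_wedge] bilinear_radd[OF bilinear_wedge]
  bilinear_lmul[OF bilinear_wedge] bilinear_rmul[OF bilinear_wedge]
  bilinear_lzero[OF bilinear_wedge] bilinear_rzero[OF bilinear_wedge]
  bilinear_lneg[OF bilinear_wedge] bilinear_rneg[OF bilinear_wedge]

lemma linear_wedge_right: "linear (\<lambda>Y. X \<curlywedge> Y)"
  and linear_wedge_left: "linear (\<lambda>X. X \<curlywedge> Y)"
  using bilinear_wedge by (auto simp: bilinear_def)

lemma inner_lcontr: "lcontr X Y \<bullet> Z = Y \<bullet> (mv_rev X \<curlywedge> Z)"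
proof -
  have adj: "adjoint (\<lambda>Z. mv_rev X \<curlywedge> Z) Y \<bullet> Z = Y \<bullet> (mv_rev X \<curlywedge> Z)" for Z
    using adjoint_works[OF linear_wedge_right] by (metis inner_commute)
  have "\<forall>Z. lcontr X Y \<bullet> Z = Y \<bullet> (mv_rev X \<curlywedge> Z)"
    unfolding lcontr_def
  proof (rule theI)
    show "\<forall>Z. adjoint (\<lambda>Z. mv_rev X \<curlywedge> Z) Y \<bullet> Z = Y \<bullet> (mv_rev X \<curlywedge> Z)"
      using adj by blast
  next
    fix W assume "\<forall>Z. W \<bullet> Z = Y \<bullet> (mv_rev X \<curlywedge> Z)"
    then have "\<forall>Z. W \<bullet> Z = adjoint (\<lambda>Z. mv_rev X \<curlywedge> Z) Y \<bullet> Z"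
      using adj by simp
    then show "W = adjoint (\<lambda>Z. mv_rev X \<curlywedge> Z) Y"
      by (rule vector_eq_rdot[THEN iffD1])
  qed
  then show ?thesis by blast
qed

lemma blade_sign_Un:
  fixes A B C :: "'n::{finite,linorder} set"
  shows "A \<inter> B = {} \<Longrightarrow> blade_sign (A \<union> B) C = blade_sign A C * blade_sign B C"
    and "A \<inter> B = {} \<Longrightarrow> blade_sign C (A \<union> B) = blade_sign C A * blade_sign C B"
proof -
  assume d: "A \<inter> B = {}"
  have "{(a, b). a \<in> A \<union> B \<and> b \<in> C \<and> b < a} =
      {(a, b). a \<in> A \<and> b \<in> C \<and> b < a} \<union> {(a, b). a \<in> B \<and> b \<in> C \<and> b < a}" by auto
  moreover have "card \<dots> = card {(a, b). a \<in> A \<and> b \<in> C \<and> b < a} + card {(a, b). a \<in> B \<and> b \<in> C \<and> b < a}"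
    using d by (intro card_Un_disjoint) auto
  ultimately show "blade_sign (A \<union> B) C = blade_sign A C * blade_sign B C"
    by (simp add: blade_sign_def power_add)
  have "{(a, b). a \<in> C \<and> b \<in> A \<union> B \<and> b < a} =
      {(a, b). a \<in> C \<and> b \<in> A \<and> b < a} \<union> {(a, b). a \<in> C \<and> b \<in> B \<and> b < a}" by auto
  moreover have "card \<dots> = card {(a, b). a \<in> C \<and> b \<in> A \<and> b < a} + card {(a, b). a \<in> C \<and> b \<in> B \<and> b < a}"
    using d by (intro card_Un_disjoint) auto
  ultimately show "blade_sign C (A \<union> B) = blade_sign C A * blade_sign C B"
    by (simp add: blade_sign_def power_add)
qed

lemma wedge_assoc: "(X \<curlywedge> Y) \<curlywedge> Z = X \<curlywedge> (Y \<curlywedge> Z)"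
proof (unfold vec_eq_iff, intro allI)
  fix D
  let ?t = "\<lambda>A B. blade_sign A B * blade_sign A (D - (A \<union> B)) * blade_sign B (D - (A \<union> B)) *
      X $ A * Y $ B * Z $ (D - (A \<union> B))"
  have "((X \<curlywedge> Y) \<curlywedge> Z) $ D = (\<Sum>C\<in>Pow D. \<Sum>A\<in>Pow C. ?t A (C - A))"
  proof -
    have "blade_sign C (D - C) * (blade_sign A (C - A) * X $ A * Y $ (C - A)) * Z $ (D - C) = ?t A (C - A)"
      if "C \<subseteq> D" "A \<subseteq> C" for A C
    proof -
      have e: "A \<union> C = C" using that by auto
      have "blade_sign C (D - C) = blade_sign A (D - C) * blade_sign (C - A) (D - C)"
        using blade_sign_Un(1)[of A "C - A" "D - C"] that by (simp add: e)
      then show ?thesis by (simp add: e)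
    qed
    then show ?thesis
      by (auto simp: wedge_def sum_distrib_left sum_distrib_right intro!: sum.cong)
  qed
  also have "\<dots> = (\<Sum>(C, A)\<in>Sigma (Pow D) Pow. ?t A (C - A))"
    by (subst sum.Sigma) auto
  also have "\<dots> = (\<Sum>(A, B)\<in>Sigma (Pow D) (\<lambda>A. Pow (D - A)). ?t A B)"
    by (rule sum.reindex_bij_witness[where i = "\<lambda>(A, B). (A \<union> B, A)" and j = "\<lambda>(C, A). (A, C - A)"]) auto
  also have "\<dots> = (\<Sum>A\<in>Pow D. \<Sum>B\<in>Pow (D - A). ?t A B)"
    by (subst sum.Sigma) auto
  also have "\<dots> = (X \<curlywedge> (Y \<curlywedge> Z)) $ D"
  proof -
    have "blade_sign A (D - A) * X $ A * (blade_sign B (D - A - B) * Y $ B * Z $ (D - A - B)) = ?t A B"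
      if "A \<subseteq> D" "B \<subseteq> D - A" for A B
    proof -
      have e: "B \<union> (D - (A \<union> B)) = D - A" "D - A - B = D - (A \<union> B)" using that by auto
      have "blade_sign A (D - A) = blade_sign A B * blade_sign A (D - (A \<union> B))"
        using blade_sign_Un(2)[of B "D - (A \<union> B)" A] unfolding e by blast
      then show ?thesis by (simp add: e)
    qed
    then show ?thesis
      unfolding wedge_def vec_lambda_beta sum_distrib_left
      by (intro sum.cong refl) (metis PowD)
  qed
  finally show "((X \<curlywedge> Y) \<curlywedge> Z) $ D = (X \<curlywedge> (Y \<curlywedge> Z)) $ D" .
qed

lemma blade_sign_empty [simp]: "blade_sign A {} = 1" "blade_sign {} A = 1"
  by (simp_all add: blade_sign_def)

lemma wedge_one_right: "X \<curlywedge> axis {} 1 = X"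
proof -
  have "(X \<curlywedge> axis {} 1) $ C = X $ C" for C
  proof -
    have e: "A = C" if "A \<subseteq> C" "C - A = {}" for A using that by auto
    have "(X \<curlywedge> axis {} 1) $ C = (\<Sum>A\<in>Pow C. if A = C then X $ A else 0)"
      unfolding wedge_def vec_lambda_beta by (intro sum.cong refl) (use e in \<open>auto simp: axis_def\<close>)
    then show ?thesis by simp
  qed
  then show ?thesis by (simp add: vec_eq_iff)
qed

lemma wedge_one_left: "axis {} 1 \<curlywedge> X = X"
proof -
  have "(axis {} 1 \<curlywedge> X) $ C = X $ C" for C
  proof -
    have "(axis {} 1 \<curlywedge> X) $ C = (\<Sum>A\<in>Pow C. if A = {} then X $ C else 0)"
      unfolding wedge_def vec_lambda_beta by (intro sum.cong refl) (auto simp: axis_def)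
    then show ?thesis by simp
  qed
  then show ?thesis by (simp add: vec_eq_iff)
qed

lemma blade_expansion: "X = (\<Sum>A\<in>UNIV. X $ A *\<^sub>R axis A 1)"
  using basis_expansion[of X] by (simp add: scalar_mult_eq_scaleR)

lemma vec_mv_axis: "vec_mv (axis i 1) = axis {i} 1"
proof -
  have "vec_mv (axis i 1 :: real ^ 'a) = (\<Sum>j\<in>UNIV. if j = i then axis {j} 1 else 0)"
    unfolding vec_mv_def by (intro sum.cong) (auto simp: axis_def)
  then show ?thesis by simp
qed

lemma linear_vec_mv: "linear vec_mv"
  by (auto intro!: linearI simp: vec_mv_def algebra_simps sum.distrib scaleR_sum_right)

lemma wedge_axis:
  "axis A 1 \<curlywedge> axis B 1 = (if A \<inter> B = {} then blade_sign A B *\<^sub>R axis (A \<union> B) 1 else 0)"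
proof -
  have "(axis A 1 \<curlywedge> axis B 1) $ C =
      (if A \<inter> B = {} then blade_sign A B *\<^sub>R axis (A \<union> B) 1 else 0) $ C" for C :: "'a set"
  proof -
    have "(axis A 1 \<curlywedge> axis B 1) $ C =
        (\<Sum>A'\<in>Pow C. if A' = A then blade_sign A (C - A) * axis B 1 $ (C - A) else 0)"
      unfolding wedge_def vec_lambda_beta by (intro sum.cong refl) (simp add: axis_def)
    also have "\<dots> = (if A \<subseteq> C then blade_sign A (C - A) * axis B 1 $ (C - A) else 0)"
      by simp
    also have "\<dots> = (if A \<inter> B = {} then blade_sign A B *\<^sub>R axis (A \<union> B) 1 else 0) $ C"
    proof (cases "A \<subseteq> C \<and> C - A = B")
      case True
      then have "A \<inter> B = {}" "A \<union> B = C" by auto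
      with True show ?thesis by (simp add: axis_def)
    next
      case False
      then have "A \<inter> B = {} \<Longrightarrow> A \<union> B \<noteq> C" by auto
      with False show ?thesis by (auto simp: axis_def)
    qed
    finally show ?thesis .
  qed
  then show ?thesis by (simp add: vec_eq_iff)
qed

lemma vec_mv_wedge_commute: "vec_mv v \<curlywedge> vec_mv w = - (vec_mv w \<curlywedge> vec_mv v)"
proof -
  have ax: "axis {i} 1 \<curlywedge> axis {j} 1 = - (axis {j} 1 \<curlywedge> axis {i} (1::real))" for i j :: 'a
  proof -
    have 1: "{(a, b). a = i \<and> b = j \<and> b < a} = (if j < i then {(i, j)} else {})"
      "{(a, b). a = j \<and> b = i \<and> b < a} = (if i < j then {(j, i)} else {})" by auto
    show ?thesis
      by (cases i j rule: linorder_cases) (auto simp: wedge_axis blade_sign_def 1 insert_commute)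
  qed
  have "vec_mv v \<curlywedge> vec_mv w = (\<Sum>(i, j)\<in>UNIV \<times> UNIV. (v $ i *\<^sub>R axis {i} 1) \<curlywedge> (w $ j *\<^sub>R axis {j} 1))"
    unfolding vec_mv_def by (rule bilinear_sum[OF bilinear_wedge])
  also have "\<dots> = (\<Sum>i\<in>UNIV. \<Sum>j\<in>UNIV. v $ i *\<^sub>R w $ j *\<^sub>R (axis {i} 1 \<curlywedge> axis {j} 1))"
    by (simp add: sum.cartesian_product wedge_bilinear_simps mult.commute)
  also have "\<dots> = (\<Sum>j\<in>UNIV. \<Sum>i\<in>UNIV. v $ i *\<^sub>R w $ j *\<^sub>R (axis {i} 1 \<curlywedge> axis {j} 1))"
    by (rule sum.swap)
  also have "\<dots> = (\<Sum>j\<in>UNIV. \<Sum>i\<in>UNIV. - (w $ j *\<^sub>R v $ i *\<^sub>R (axis {j} 1 \<curlywedge> axis {i} 1)))"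
    by (intro sum.cong refl, subst ax) (simp add: algebra_simps)
  also have "\<dots> = - (\<Sum>(j, i)\<in>UNIV \<times> UNIV. (w $ j *\<^sub>R axis {j} 1) \<curlywedge> (v $ i *\<^sub>R axis {i} 1))"
    by (simp add: sum.cartesian_product wedge_bilinear_simps sum_negf case_prod_unfold mult.commute)
  also have "\<dots> = - (vec_mv w \<curlywedge> vec_mv v)"
    unfolding vec_mv_def by (subst bilinear_sum[OF bilinear_wedge]) (rule refl)
  finally show ?thesis .
qed

lemma vec_mv_wedge_self: "vec_mv v \<curlywedge> vec_mv v = 0"
proof -
  have "(vec_mv v \<curlywedge> vec_mv v) $ A = - (vec_mv v \<curlywedge> vec_mv v) $ A" for A
    using vec_mv_wedge_commute[of v v] by (metis vector_uminus_component)
  then show ?thesis by (simp add: vec_eq_iff)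
qed


lemma wedge_list_simps [simp]:
  "wedge_list [] = axis {} 1"
  "wedge_list (v # vs) = vec_mv v \<curlywedge> wedge_list vs"
  by (simp_all add: wedge_list_def)

lemma vec_mv_wedge_swap: "vec_mv v \<curlywedge> (vec_mv w \<curlywedge> X) = - (vec_mv w \<curlywedge> (vec_mv v \<curlywedge> X))"
  by (metis vec_mv_wedge_commute wedge_assoc bilinear_lneg[OF bilinear_wedge])

lemma wedge_list_sorted:
  "vec_mv (u i) \<curlywedge> wedge_list (map u (sorted_list_of_set A)) =
    (if i \<in> A then 0 else blade_sign {i} A *\<^sub>R wedge_list (map u (sorted_list_of_set (insert i A))))"
  for A :: "'n::{finite,linorder} set"
proof -
  have srt: "sorted_list_of_set (insert m A) = m # sorted_list_of_set A"
    if "\<forall>a\<in>A. m < a" for m and A :: "'n set"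
    using that sorted_list_of_set_nonempty[of "insert m A"]
    by (metis Diff_insert_absorb Min_insert2 finite insert_not_empty less_irrefl less_imp_le)
  have "finite A" by simp
  then show ?thesis
  proof (induction A rule: finite_linorder_min_induct)
    case empty
    then show ?case by simp
  next
    case (insert m A)
    have m: "m \<notin> A" using insert by blast
    consider "i < m" | "i = m" | "m < i" by fastforce
    then show ?case
    proof cases
      case 1
      then have lt: "\<forall>a\<in>insert m A. i < a" using insert by auto
      then have "{(a, b). a \<in> {i} \<and> b \<in> insert m A \<and> b < a} = {}" by fastforce
      then have "blade_sign {i} (insert m A) = 1"
        unfolding blade_sign_def by (metis card.empty power_0)
      with lt show ?thesis by (auto simp: srt[OF lt])
    next
      case 2
      then show ?thesis
        using srt[OF insert.hyps(2)]
        by (simp del: sorted_list_of_set_insert_remove add: wedge_assoc[symmetric] vec_mv_wedge_self wedge_bilinear_simps)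
    next
      case 3
      have "{(a, b). a \<in> {i} \<and> b \<in> {m} \<and> b < a} = {(i, m)}" using 3 by auto
      then have "blade_sign {i} {m} = - 1"
        unfolding blade_sign_def by (metis card_1_singleton_iff power_one_right One_nat_def)
      then have sg: "blade_sign {i} (insert m A) = - blade_sign {i} A"
        using blade_sign_Un(2)[of "{m}" A "{i}"] m by simp
      have lt: "\<forall>a\<in>insert i A. m < a" using insert.hyps 3 by auto
      have "vec_mv (u i) \<curlywedge> wedge_list (map u (sorted_list_of_set (insert m A))) =
          - (vec_mv (u m) \<curlywedge> (vec_mv (u i) \<curlywedge> wedge_list (map u (sorted_list_of_set A))))"
        using srt[OF insert.hyps(2)]
        by (simp del: sorted_list_of_set_insert_remove add: vec_mv_wedge_swap[of "u i"])
      then show ?thesis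
        using 3 srt[OF lt] by (auto simp: insert.IH sg wedge_bilinear_simps insert_commute)
    qed
  qed
qed

lemma linear_ext_map: "linear (ext_map f)"
  by (auto intro!: linearI simp: ext_map_def algebra_simps sum.distrib scaleR_sum_right)

lemma ext_map_axis: "ext_map f (axis A 1) = wedge_list (map (\<lambda>i. f (axis i 1)) (sorted_list_of_set A))"
proof -
  have "ext_map f (axis A 1) =
      (\<Sum>B\<in>UNIV. if B = A then wedge_list (map (\<lambda>i. f (axis i 1)) (sorted_list_of_set B)) else 0)"
    unfolding ext_map_def by (intro sum.cong) (auto simp: axis_def)
  then show ?thesis by simp
qed

lemma ext_map_vec_wedge:
  fixes f :: "(real, 'a::{finite,linorder}) vec \<Rightarrow> (real, 'a) vec"
  assumes "linear f"
  shows "ext_map f (vec_mv v \<curlywedge> X) = vec_mv (f v) \<curlywedge> ext_map f X"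
proof -
  have l1: "linear (\<lambda>v. ext_map f (vec_mv v \<curlywedge> X))" for X
    using linear_compose[OF linear_compose[OF linear_vec_mv linear_wedge_left] linear_ext_map]
    by (simp add: o_def)
  have l2: "linear (\<lambda>X. ext_map f (vec_mv v \<curlywedge> X))" for v
    using linear_compose[OF linear_wedge_right linear_ext_map] by (simp add: o_def)
  have r1: "linear (\<lambda>v. vec_mv (f v) \<curlywedge> ext_map f X)" for X
    using linear_compose[OF linear_compose[OF assms linear_vec_mv] linear_wedge_left]
    by (simp add: o_def)
  have r2: "linear (\<lambda>X. vec_mv (f v) \<curlywedge> ext_map f X)" for v
    using linear_compose[OF linear_ext_map linear_wedge_right] by (simp add: o_def)
  have "(\<lambda>v X. ext_map f (vec_mv v \<curlywedge> X)) = (\<lambda>v X. vec_mv (f v) \<curlywedge> ext_map f X)"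
  proof (rule bilinear_eq_stdbasis)
    fix v :: "(real, 'a) vec" and X :: "'a multivector"
    assume "v \<in> Basis" "X \<in> Basis"
    then obtain i A where e: "v = axis i 1" "X = axis A 1" by (auto simp: Basis_vec_def)
    show "ext_map f (vec_mv v \<curlywedge> X) = vec_mv (f v) \<curlywedge> ext_map f X"
      using wedge_list_sorted[of "\<lambda>i. f (axis i 1)" i A]
      by (auto simp: e vec_mv_axis wedge_axis ext_map_axis linear_cmul[OF linear_ext_map]
          linear_0[OF linear_ext_map])
  qed (simp_all add: bilinear_def l1 l2 r1 r2)
  then show ?thesis by metis
qed

lemma ext_map_wedge_list: "linear f \<Longrightarrow> ext_map f (wedge_list vs) = wedge_list (map f vs)"
  by (induction vs) (simp_all add: ext_map_vec_wedge ext_map_axis)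

lemma wedge_list_axis: "wedge_list (map (\<lambda>i. axis i 1) (sorted_list_of_set A)) = axis A 1"
proof -
  have "finite A" by simp
  then show ?thesis
  proof (induction A rule: finite_linorder_min_induct)
    case empty
    then show ?case by simp
  next
    case (insert m A)
    have e: "sorted_list_of_set (insert m A) = m # sorted_list_of_set A"
      using insert sorted_list_of_set_nonempty[of "insert m A"]
      by (metis Diff_insert_absorb Min_insert2 finite insert_not_empty less_irrefl less_imp_le)
    have "{(a, b). a \<in> {m} \<and> b \<in> A \<and> b < a} = {}" using insert by fastforce
    then have "blade_sign {m} A = 1"
      unfolding blade_sign_def by (metis card.empty power_0)
    moreover have "m \<notin> A" using insert by blast
    ultimately show ?case by (simp add: e insert.IH vec_mv_axis wedge_axis)
  qed
qed

lemma wedge_list_grade: "card A \<noteq> length vs \<Longrightarrow> wedge_list vs $ A = 0"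
proof (induction vs arbitrary: A)
  case Nil
  then show ?case by (auto simp: axis_def)
next
  case (Cons v vs)
  have "vec_mv v $ B * wedge_list vs $ (A - B) = 0" if "B \<subseteq> A" for B
  proof (cases "card B = 1")
    case True
    then have "card (A - B) \<noteq> length vs"
      using Cons.prems that card_Diff_subset[of B A] card_mono[of A B] by auto
    then show ?thesis using Cons.IH by simp
  next
    case False
    then have "vec_mv v $ B = 0"
      unfolding vec_mv_def by (auto simp: axis_def intro!: sum.neutral)
    then show ?thesis by simp
  qed
  then have "blade_sign B (A - B) * vec_mv v $ B * wedge_list vs $ (A - B) = 0" if "B \<subseteq> A" for B
    using that by (metis mult.assoc mult_zero_right)
  then show ?case unfolding wedge_list_simps wedge_def vec_lambda_beta by (intro sum.neutral) auto
qed

lemma linear_mv_rev: "linear mv_rev"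
  by (auto intro!: linearI simp: mv_rev_def vec_eq_iff algebra_simps)

lemma mv_rev_vec_mv: "mv_rev (vec_mv v) = vec_mv v"
  by (auto simp: mv_rev_def vec_mv_def vec_eq_iff axis_def sum_distrib_left intro!: sum.cong)

lemma bilinear_lcontr: "bilinear lcontr"
proof -
  have eqI: "X = Y" if "\<And>Z. X \<bullet> Z = Y \<bullet> Z" for X Y :: "'a multivector"
    using that vector_eq_rdot by blast
  show ?thesis
    unfolding bilinear_def
    by (intro conjI allI linearI; rule eqI)
      (simp_all add: inner_lcontr inner_add linear_add[OF linear_mv_rev]
        linear_cmul[OF linear_mv_rev] wedge_bilinear_simps)
qed

lemma inner_vec_mv_lcontr: "lcontr (vec_mv v) Y \<bullet> Z = Y \<bullet> (vec_mv v \<curlywedge> Z)"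
  by (simp add: inner_lcontr mv_rev_vec_mv)

lemma lcontr_axis:
  "lcontr (axis {i} 1) (axis A 1) = (if i \<in> A then blade_sign {i} (A - {i}) *\<^sub>R axis (A - {i}) 1 else 0)"
proof -
  have "lcontr (axis {i} 1) (axis A 1) $ B =
      (if i \<in> A then blade_sign {i} (A - {i}) *\<^sub>R axis (A - {i}) 1 else 0) $ B" for B
  proof -
    have "lcontr (axis {i} 1) (axis A 1) $ B = lcontr (vec_mv (axis i 1)) (axis A 1) \<bullet> axis B 1"
      by (simp add: vec_mv_axis inner_axis)
    also have "\<dots> = axis A 1 \<bullet> (axis {i} 1 \<curlywedge> axis B 1)"
      by (metis inner_vec_mv_lcontr vec_mv_axis)
    also have "\<dots> = (if i \<in> A then blade_sign {i} (A - {i}) *\<^sub>R axis (A - {i}) 1 else 0) $ B"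
      by (simp add: wedge_axis inner_axis_axis) (auto simp: axis_def)
    finally show ?thesis .
  qed
  then show ?thesis by (simp add: vec_eq_iff)
qed

lemma lcontr_vec_wedge:
  "lcontr (vec_mv v) (vec_mv w \<curlywedge> X) = (v \<bullet> w) *\<^sub>R X - vec_mv w \<curlywedge> lcontr (vec_mv v) X"
proof -
  have basis: "(axis {j} 1 \<curlywedge> axis A 1) \<bullet> (axis {i} 1 \<curlywedge> axis B 1) =
      (axis i 1 \<bullet> axis j (1::real)) * (axis A 1 \<bullet> axis B (1::real)) -
      lcontr (axis {i} 1) (axis A 1) \<bullet> lcontr (axis {j} 1) (axis B (1::real))"
    for i j :: 'a and A B
  proof (cases "i = j")
    case True
    have sq: "blade_sign C D * blade_sign C D = 1" for C D :: "'a set"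
      by (simp add: blade_sign_def power_mult_distrib[symmetric])
    show ?thesis
    proof (cases "i \<in> A \<longleftrightarrow> i \<in> B")
      case t: True
      then have "A - {i} = B - {i} \<longleftrightarrow> A = B" "insert i A = insert i B \<longleftrightarrow> A = B" by auto
      with t True show ?thesis by (auto simp: wedge_axis lcontr_axis inner_axis_axis inner_real_def sq)
    next
      case f: False
      then have "A \<noteq> B" by auto
      with f True show ?thesis by (auto simp: wedge_axis lcontr_axis inner_axis_axis)
    qed
  next
    case False
    show ?thesis
    proof (cases "i \<in> A \<and> j \<notin> A \<and> j \<in> B \<and> i \<notin> B \<and> A - {i} = B - {j}")
      case True
      define D where "D = A - {i}"
      have AB: "A = {i} \<union> D" "B = {j} \<union> D" and D: "i \<notin> D" "j \<notin> D"
        using True by (auto simp: D_def)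
      have "blade_sign {i} {j} * blade_sign {j} {i} = - 1"
      proof -
        have "{(a, b). a \<in> {k} \<and> b \<in> {l} \<and> b < a} = (if l < k then {(k, l)} else {})" for k l :: 'a
          by auto
        then show ?thesis using False
          by (cases i j rule: linorder_cases) (auto simp: blade_sign_def)
      qed
      moreover have "blade_sign {j} A = blade_sign {j} {i} * blade_sign {j} D"
        "blade_sign {i} B = blade_sign {i} {j} * blade_sign {i} D"
        unfolding AB using D by (intro blade_sign_Un(2); simp)+
      ultimately have s: "blade_sign {j} A * blade_sign {i} B = - (blade_sign {i} D * blade_sign {j} D)"
        by (metis (no_types, opaque_lifting) mult.assoc mult.commute mult_minus1)
      have e: "A - {i} = D" "B - {j} = D" "insert j A = insert i B"
        using AB D by auto
      show ?thesis using True False s e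
        by (simp add: wedge_axis lcontr_axis inner_axis_axis mult.commute)
    next
      case f: False
      have 1: "insert j A \<noteq> insert i B" if "j \<notin> A" "i \<notin> B"
        using f that False by auto
      have 2: "A - {i} \<noteq> B - {j}" if "i \<in> A" "j \<in> B"
        using f that False by auto
      show ?thesis using False 1 2
        by (auto simp: wedge_axis lcontr_axis inner_axis_axis)
    qed
  qed
  have lv: "linear (\<lambda>v. vec_mv v \<curlywedge> X)" for X :: "'a multivector"
    using linear_compose[OF linear_vec_mv linear_wedge_left] by (simp add: o_def)
  have lc: "linear (\<lambda>v. lcontr (vec_mv v) X)" "linear (\<lambda>X. lcontr Y X)" for X Y :: "'a multivector"
    using linear_compose[OF linear_vec_mv, of "\<lambda>Y. lcontr Y X"] bilinear_lcontr
    by (auto simp: o_def bilinear_def)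
  note lin = linear_add[OF lv] linear_cmul[OF lv] linear_add[OF lc(1)] linear_cmul[OF lc(1)]
    linear_add[OF lc(2)] linear_cmul[OF lc(2)] wedge_bilinear_simps inner_add algebra_simps
  have ax: "(\<lambda>X Z. (vec_mv (axis j 1) \<curlywedge> X) \<bullet> (vec_mv (axis i 1) \<curlywedge> Z)) =
      (\<lambda>X Z. (axis i 1 \<bullet> axis j (1::real)) * (X \<bullet> Z) -
        lcontr (vec_mv (axis i 1)) X \<bullet> lcontr (vec_mv (axis j 1)) Z)" for i j :: 'a
  proof (rule bilinear_eq_stdbasis)
    fix X Z :: "'a multivector"
    assume "X \<in> Basis" "Z \<in> Basis"
    then obtain A B where "X = axis A 1" "Z = axis B 1" by (auto simp: Basis_vec_def)
    then show "(vec_mv (axis j 1) \<curlywedge> X) \<bullet> (vec_mv (axis i 1) \<curlywedge> Z) =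
        (axis i 1 \<bullet> axis j (1::real)) * (X \<bullet> Z) -
        lcontr (vec_mv (axis i 1)) X \<bullet> lcontr (vec_mv (axis j 1)) Z"
      using basis by (simp add: vec_mv_axis)
  qed (auto simp: bilinear_def lin intro!: linearI)
  have "(\<lambda>v w. (vec_mv w \<curlywedge> X) \<bullet> (vec_mv v \<curlywedge> Z)) =
      (\<lambda>v w. (v \<bullet> w) * (X \<bullet> Z) - lcontr (vec_mv v) X \<bullet> lcontr (vec_mv w) Z)" for X Z :: "'a multivector"
  proof (rule bilinear_eq_stdbasis)
    fix v w :: "(real, 'a) vec"
    assume "v \<in> Basis" "w \<in> Basis"
    then obtain i j where "v = axis i 1" "w = axis j 1" by (auto simp: Basis_vec_def)
    then show "(vec_mv w \<curlywedge> X) \<bullet> (vec_mv v \<curlywedge> Z) =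
        (v \<bullet> w) * (X \<bullet> Z) - lcontr (vec_mv v) X \<bullet> lcontr (vec_mv w) Z"
      using fun_cong[OF fun_cong[OF ax[of j i]], of X Z] by simp
  qed (auto simp: bilinear_def lin intro!: linearI)
  then have *: "(vec_mv w \<curlywedge> X) \<bullet> (vec_mv v \<curlywedge> Z) =
      (v \<bullet> w) * (X \<bullet> Z) - lcontr (vec_mv v) X \<bullet> lcontr (vec_mv w) Z" for Z
    by metis
  have "lcontr (vec_mv v) X \<bullet> lcontr (vec_mv w) Z = (vec_mv w \<curlywedge> lcontr (vec_mv v) X) \<bullet> Z" for Z
    by (metis inner_vec_mv_lcontr inner_commute)
  with * have "lcontr (vec_mv v) (vec_mv w \<curlywedge> X) \<bullet> Z =
      ((v \<bullet> w) *\<^sub>R X - vec_mv w \<curlywedge> lcontr (vec_mv v) X) \<bullet> Z" for Z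
    by (simp add: inner_vec_mv_lcontr inner_diff)
  then show ?thesis using vector_eq_rdot by blast
qed

lemma vec_wedge_lcontr_wedge_list:
  assumes "distinct js"
  shows "vec_mv x \<curlywedge> lcontr (vec_mv v) (wedge_list (map w js)) =
    (\<Sum>b\<in>set js. (v \<bullet> w b) *\<^sub>R wedge_list (map (w(b := x)) js))"
  using assms
proof (induction js)
  case Nil
  have "lcontr (vec_mv v) (axis {} 1) = 0"
  proof -
    have "lcontr (vec_mv v) (axis {} 1) \<bullet> Z = 0" for Z
      unfolding inner_vec_mv_lcontr by (simp add: inner_axis' wedge_def) (simp add: vec_mv_def axis_def)
    then show ?thesis by (metis inner_eq_zero_iff)
  qed
  then show ?case by (simp add: wedge_bilinear_simps)
next
  case (Cons j js)
  have upd: "map (w(j := x)) js = map w js" using Cons.prems by simp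
  have upd2: "(w(b := x)) j = w j" if "b \<in> set js" for b
    using Cons.prems that by auto
  have "vec_mv x \<curlywedge> lcontr (vec_mv v) (wedge_list (map w (j # js))) =
      (v \<bullet> w j) *\<^sub>R (vec_mv x \<curlywedge> wedge_list (map w js)) +
      vec_mv (w j) \<curlywedge> (vec_mv x \<curlywedge> lcontr (vec_mv v) (wedge_list (map w js)))"
    by (simp add: lcontr_vec_wedge wedge_bilinear_simps bilinear_rsub[OF bilinear_wedge]
        vec_mv_wedge_swap[of x])
  also have "vec_mv (w j) \<curlywedge> (vec_mv x \<curlywedge> lcontr (vec_mv v) (wedge_list (map w js))) =
      (\<Sum>b\<in>set js. (v \<bullet> w b) *\<^sub>R wedge_list (map (w(b := x)) (j # js)))"
    using Cons upd2 by (simp add: linear_sum[OF linear_wedge_right] wedge_bilinear_simps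
        del: fun_upd_apply cong: sum.cong)
  finally show ?case using Cons.prems upd by (simp del: fun_upd_apply add: fun_upd_same)
qed

lemma inner_wedge_list_permutes:
  assumes "distinct js"
  shows "wedge_list (map v js) \<bullet> wedge_list (map w js) =
    (\<Sum>p | p permutes set js. of_int (sign p) * (\<Prod>i\<in>set js. v i \<bullet> w (p i)))"
  using assms
proof (induction js arbitrary: w)
  case Nil
  then show ?case by (simp add: inner_axis_axis)
next
  case (Cons a js)
  let ?S = "set js" and ?P = "wedge_list (map v js)"
  let ?t = "\<lambda>p. of_int (sign p) * (\<Prod>i\<in>insert a ?S. v i \<bullet> w (p i)) :: real"
  have a: "a \<notin> ?S" and d: "distinct js" using Cons.prems by auto
  have "wedge_list (map v (a # js)) \<bullet> wedge_list (map w (a # js)) =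
      ?P \<bullet> lcontr (vec_mv (v a)) (vec_mv (w a) \<curlywedge> wedge_list (map w js))"
    by (metis inner_vec_mv_lcontr inner_commute list.simps(9) wedge_list_simps(2))
  also have "\<dots> = (v a \<bullet> w a) * (?P \<bullet> wedge_list (map w js)) -
      (\<Sum>b\<in>?S. (v a \<bullet> w b) * (?P \<bullet> wedge_list (map (w(b := w a)) js)))"
    by (simp add: lcontr_vec_wedge vec_wedge_lcontr_wedge_list[OF d] inner_diff inner_sum_right)
  also have "\<dots> = (\<Sum>b\<in>insert a ?S. \<Sum>q | q permutes ?S. ?t (Transposition.transpose a b \<circ> q))"
  proof -
    have fin: "finite {q. q permutes ?S}" by (simp add: finite_permutations)
    have 1: "?t (Transposition.transpose a a \<circ> q) = (v a \<bullet> w a) * (of_int (sign q) * (\<Prod>i\<in>?S. v i \<bullet> w (q i)))"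
      if "q permutes ?S" for q
      using that a by (simp add: permutes_not_in)
    have 2: "?t (Transposition.transpose a b \<circ> q) =
        - ((v a \<bullet> w b) * (of_int (sign q) * (\<Prod>i\<in>?S. v i \<bullet> (w(b := w a)) (q i))))"
      if q: "q permutes ?S" and b: "b \<in> ?S" for q b
    proof -
      have ne: "a \<noteq> b" using a b by auto
      have "permutation q" using q by (auto simp: permutation_permutes)
      then have "sign (Transposition.transpose a b \<circ> q) = - sign q"
        using ne by (simp add: sign_compose permutation_swap_id sign_swap_id)
      moreover have "w ((Transposition.transpose a b \<circ> q) i) = (w(b := w a)) (q i)" if "i \<in> ?S" for i
        using permutes_in_image[OF q, of i] that a by (auto simp: Transposition.transpose_def)
      moreover have "(Transposition.transpose a b \<circ> q) a = b"
        using q a by (simp add: permutes_not_in)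
      ultimately show ?thesis using a by simp
    qed
    have "(\<Sum>b\<in>insert a ?S. \<Sum>q | q permutes ?S. ?t (Transposition.transpose a b \<circ> q)) =
        (\<Sum>q | q permutes ?S. ?t (Transposition.transpose a a \<circ> q)) +
        (\<Sum>b\<in>?S. \<Sum>q | q permutes ?S. ?t (Transposition.transpose a b \<circ> q))"
      using a by (subst sum.insert) auto
    also have "(\<Sum>q | q permutes ?S. ?t (Transposition.transpose a a \<circ> q)) = (v a \<bullet> w a) * (?P \<bullet> wedge_list (map w js))"
      unfolding Cons.IH[OF d] sum_distrib_left by (intro sum.cong refl 1) simp
    also have "(\<Sum>b\<in>?S. \<Sum>q | q permutes ?S. ?t (Transposition.transpose a b \<circ> q)) =
        (\<Sum>b\<in>?S. - ((v a \<bullet> w b) * (?P \<bullet> wedge_list (map (w(b := w a)) js))))"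
      unfolding Cons.IH[OF d] sum_distrib_left sum_negf[symmetric]
      by (intro sum.cong refl 2) simp_all
    finally have e: "(\<Sum>b\<in>insert a ?S. \<Sum>q | q permutes ?S. ?t (Transposition.transpose a b \<circ> q)) =
        (v a \<bullet> w a) * (?P \<bullet> wedge_list (map w js)) +
        (\<Sum>b\<in>?S. - ((v a \<bullet> w b) * (?P \<bullet> wedge_list (map (w(b := w a)) js))))" .
    show ?thesis unfolding e by (simp add: sum_negf)
  qed
  also have "\<dots> = (\<Sum>p | p permutes insert a ?S. ?t p)"
    by (rule sum_over_permutations_insert[symmetric]) (use a in auto)
  finally show ?case by simp
qed

lemma inner_wedge_list:
  assumes "length vs = length ws"
  shows "wedge_list vs \<bullet> wedge_list ws =
    (\<Sum>p | p permutes {..<length vs}. of_int (sign p) * (\<Prod>i<length vs. vs ! i \<bullet> ws ! p i))"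
proof -
  have "vs = map ((!) vs) [0..<length vs]" "ws = map ((!) ws) [0..<length vs]"
    using assms by (metis map_nth, metis map_nth)
  then have "wedge_list vs \<bullet> wedge_list ws =
      wedge_list (map ((!) vs) [0..<length vs]) \<bullet> wedge_list (map ((!) ws) [0..<length vs])"
    by simp
  also have "\<dots> = (\<Sum>p | p permutes set [0..<length vs].
      of_int (sign p) * (\<Prod>i\<in>set [0..<length vs]. vs ! i \<bullet> ws ! p i))"
    by (rule inner_wedge_list_permutes) simp
  finally show ?thesis by (simp add: atLeast0LessThan)
qed


section \<open>Smooth manifolds and smooth fields\<close>

fun Ck_on :: "nat \<Rightarrow> 'a::real_normed_vector set \<Rightarrow> ('a \<Rightarrow> 'b::real_normed_vector) \<Rightarrow> bool" where
  "Ck_on 0 S f \<longleftrightarrow> continuous_on S f"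
| "Ck_on (Suc k) S f \<longleftrightarrow> (\<forall>x\<in>S. f differentiable (at x)) \<and>
    (\<forall>v. Ck_on k S (\<lambda>x. frechet_derivative f (at x) v))"

text \<open>The set \<open>S\<close> is meant to be open.\<close>

definition smooth_on :: "'a::real_normed_vector set \<Rightarrow> ('a \<Rightarrow> 'b::real_normed_vector) \<Rightarrow> bool" where
  "smooth_on S f \<longleftrightarrow> (\<forall>k. Ck_on k S f)"

definition local_chart :: "'m topology \<Rightarrow> 'm set \<Rightarrow> ('m \<Rightarrow> real ^ 'n) \<Rightarrow> bool" where
  "local_chart M V \<phi> \<longleftrightarrow> openin M V \<and> open (\<phi> ` V) \<and>
    homeomorphic_map (subtopology M V) (top_of_set (\<phi> ` V)) \<phi>"

definition smooth_compatible ::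
    "'m set \<Rightarrow> ('m \<Rightarrow> real ^ 'n) \<Rightarrow> 'm set \<Rightarrow> ('m \<Rightarrow> real ^ 'n) \<Rightarrow> bool" where
  "smooth_compatible V \<phi> W \<psi> \<longleftrightarrow>
    smooth_on (\<phi> ` (V \<inter> W)) (\<psi> \<circ> inv_into V \<phi>) \<and> smooth_on (\<psi> ` (V \<inter> W)) (\<phi> \<circ> inv_into W \<psi>)"

definition smooth_manifold :: "'m topology \<Rightarrow> ('m set \<times> ('m \<Rightarrow> real ^ 'n)) set \<Rightarrow> bool" where
  "smooth_manifold M \<A> \<longleftrightarrow> Hausdorff_space M \<and> second_countable M \<and>
    (\<forall>(V, \<phi>)\<in>\<A>. local_chart M V \<phi>) \<and> (\<Union>(V, \<phi>)\<in>\<A>. V) = topspace M \<and>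
    (\<forall>(V, \<phi>)\<in>\<A>. \<forall>(W, \<psi>)\<in>\<A>. smooth_compatible V \<phi> W \<psi>)"

text \<open>The charts of the manifold are the members of the maximal atlas containing \<open>\<A>\<close>.\<close>

definition smooth_chart ::
    "'m topology \<Rightarrow> ('m set \<times> ('m \<Rightarrow> real ^ 'n)) set \<Rightarrow> 'm set \<Rightarrow> ('m \<Rightarrow> real ^ 'n) \<Rightarrow> bool" where
  "smooth_chart M \<A> V \<phi> \<longleftrightarrow> local_chart M V \<phi> \<and> (\<forall>(W, \<psi>)\<in>\<A>. smooth_compatible V \<phi> W \<psi>)"

definition smooth_fields ::
    "'m topology \<Rightarrow> ('m set \<times> ('m \<Rightarrow> real ^ 'n)) set \<Rightarrow> 'm set \<Rightarrow> ('m \<Rightarrow> 'b::real_normed_vector) set" where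
  "smooth_fields M \<A> U =
    {f. \<forall>V \<phi>. smooth_chart M \<A> V \<phi> \<longrightarrow> smooth_on (\<phi> ` (U \<inter> V)) (f \<circ> inv_into V \<phi>)}"

text \<open>
  For a chart \<open>(V, \<phi>)\<close> and a point \<open>p\<close> of \<open>V\<close>, the partial derivative with respect to the
  coordinate \<open>x\<^sup>\<mu> = (\<lambda>q. \<phi> q $ \<mu>)\<close>, and the operators \<open>\<partial>\<^sub>o \<lrcorner>\<close> and \<open>\<partial>\<^sub>o \<and>\<close>.
\<close>

definition coord_deriv ::
    "'m set \<Rightarrow> ('m \<Rightarrow> real ^ 'n) \<Rightarrow> 'n \<Rightarrow> ('m \<Rightarrow> 'b::real_normed_vector) \<Rightarrow> 'm \<Rightarrow> 'b" where
  "coord_deriv V \<phi> \<mu> X p =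
    vector_derivative (\<lambda>t. X (inv_into V \<phi> (\<phi> p + t *\<^sub>R axis \<mu> 1))) (at 0)"

definition deriv_lcontr ::
    "'m set \<Rightarrow> ('m \<Rightarrow> (real, 'n::{finite,linorder}) vec) \<Rightarrow> ('m \<Rightarrow> 'n multivector) \<Rightarrow> 'm \<Rightarrow> 'n multivector" where
  "deriv_lcontr V \<phi> X p = (\<Sum>\<mu>\<in>UNIV. lcontr (vec_mv (axis \<mu> 1)) (coord_deriv V \<phi> \<mu> X p))"

definition deriv_wedge ::
    "'m set \<Rightarrow> ('m \<Rightarrow> (real, 'n::{finite,linorder}) vec) \<Rightarrow> ('m \<Rightarrow> 'n multivector) \<Rightarrow> 'm \<Rightarrow> 'n multivector" where
  "deriv_wedge V \<phi> X p = (\<Sum>\<mu>\<in>UNIV. vec_mv (axis \<mu> 1) \<curlywedge> coord_deriv V \<phi> \<mu> X p)"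


section \<open>Metric structures and Hodge extensor fields\<close>

definition endo_det :: "(real ^ 'n) \<Rightarrow>\<^sub>L (real ^ 'n) \<Rightarrow> real" where
  "endo_det T = det (matrix (blinfun_apply T))"

definition metric_structure ::
    "'m topology \<Rightarrow> ('m set \<times> ('m \<Rightarrow> real ^ 'n)) set \<Rightarrow> 'm set \<Rightarrow>
      ('m \<Rightarrow> (real ^ 'n) \<Rightarrow>\<^sub>L (real ^ 'n)) \<Rightarrow> bool" where
  "metric_structure M \<A> U g \<longleftrightarrow> g \<in> smooth_fields M \<A> U \<and>
    (\<forall>p\<in>U. (\<forall>v w. g p v \<bullet> w = v \<bullet> g p w) \<and> endo_det (g p) \<noteq> 0)"

definition frame_field ::
    "'m topology \<Rightarrow> ('m set \<times> ('m \<Rightarrow> real ^ 'n)) set \<Rightarrow> 'm set \<Rightarrow> ('n \<Rightarrow> 'm \<Rightarrow> real ^ 'n) \<Rightarrow> bool" where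
  "frame_field M \<A> U e \<longleftrightarrow> (\<forall>\<mu>. e \<mu> \<in> smooth_fields M \<A> U) \<and>
    (\<forall>p\<in>U. inj (\<lambda>\<mu>. e \<mu> p) \<and> independent (range (\<lambda>\<mu>. e \<mu> p)) \<and> span (range (\<lambda>\<mu>. e \<mu> p)) = UNIV)"

definition reciprocal_frame_fields ::
    "'m topology \<Rightarrow> ('m set \<times> ('m \<Rightarrow> real ^ 'n)) set \<Rightarrow> 'm set \<Rightarrow>
      ('n \<Rightarrow> 'm \<Rightarrow> real ^ 'n) \<Rightarrow> ('n \<Rightarrow> 'm \<Rightarrow> real ^ 'n) \<Rightarrow> bool" where
  "reciprocal_frame_fields M \<A> U e e' \<longleftrightarrow> frame_field M \<A> U e \<and> frame_field M \<A> U e' \<and>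
    (\<forall>p\<in>U. \<forall>\<mu> \<nu>. e \<mu> p \<bullet> e' \<nu> p = (if \<mu> = \<nu> then 1 else 0))"

definition frame_wedge :: "('n \<Rightarrow> 'm \<Rightarrow> (real, 'n::{finite,linorder}) vec) \<Rightarrow> 'm \<Rightarrow> 'n multivector" where
  "frame_wedge e p = wedge_list (map (\<lambda>\<mu>. e \<mu> p) (sorted_list_of_set UNIV))"

definition std_volume ::
    "('n \<Rightarrow> 'm \<Rightarrow> (real, 'n::{finite,linorder}) vec) \<Rightarrow> ('n \<Rightarrow> 'm \<Rightarrow> (real, 'n) vec) \<Rightarrow> 'm \<Rightarrow> 'n multivector" where
  "std_volume e e' p = sqrt (frame_wedge e p \<bullet> frame_wedge e p) *\<^sub>R frame_wedge e' p"

text \<open>An extensor field maps a point to an operator on multivectors.\<close>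

definition std_hodge ::
    "('m \<Rightarrow> 'n::{finite,linorder} multivector) \<Rightarrow> 'm \<Rightarrow> 'n multivector \<Rightarrow> 'n multivector" where
  "std_hodge \<tau> p X = lcontr (mv_rev X) (\<tau> p)"

definition metric_hodge ::
    "('m \<Rightarrow> (real, 'n::{finite,linorder}) vec \<Rightarrow>\<^sub>L (real, 'n) vec) \<Rightarrow> ('m \<Rightarrow> 'n multivector) \<Rightarrow>
      'm \<Rightarrow> 'n multivector \<Rightarrow> 'n multivector" where
  "metric_hodge g \<tau> p X =
    sqrt \<bar>endo_det (g p)\<bar> *\<^sub>R lcontr (ext_map (inv (blinfun_apply (g p))) (mv_rev X)) (\<tau> p)"

end

theory Submission
  imports Defs
begin

text \<open>
  Write \<open>X^\<close> for \<open>grade_inv X\<close>.  Contraction by a vector is an antiderivation of the exterior product, and the exterior product of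
  a vector with the pseudoscalar \<open>I = axis UNIV 1\<close> vanishes.  Pairing with an arbitrary \<open>Z\<close> and
  contracting \<open>X^ \<curlywedge> Z\<close> by \<open>v\<close> therefore shows that \<open>v \<curlywedge> \<star>X\<close> is the Hodge dual of the negative
  of the contraction of \<open>X^\<close> by \<open>v\<close>.  The standard volume field is \<open>I\<close> times the sign of a
  continuous function without zeros, hence locally constant, so the first identity follows by applying
  this to each partial derivative of \<open>X\<close>.  The metric Hodge dual of \<open>X\<close> is the standard one of
  \<open>Y = sqrt \<bar>det g\<bar> g\<inverse>(X)\<close>, so the second identity is the first one for \<open>Y\<close>; that \<open>Y\<close> is
  differentiable follows from Cramer's rule.
\<close>

section \<open>Contraction by a vector as an antiderivation\<close>

lemma grade_inv_vec_wedge: "grade_inv (vec_mv v \<curlywedge> X) = - (vec_mv v \<curlywedge> grade_inv X)"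
proof -
  have "(-1) ^ card C * (blade_sign A (C - A) * vec_mv v $ A * X $ (C - A)) =
      - (blade_sign A (C - A) * vec_mv v $ A * ((-1) ^ card (C - A) * X $ (C - A)))"
    if "A \<subseteq> C" for A C
  \<comment> \<open>\<open>vec_mv v\<close> can be nonzero only at singletons, and removing a
    singleton from \<open>C\<close> flips the parity of its size.\<close>
  proof (cases "card A = 1")
    case True
    then have "card C = Suc (card (C - A))"
      using that card_Diff_subset[of A C] card_mono[of C A] by auto
    then show ?thesis by simp
  next
    case False
    then have "vec_mv v $ A = 0"
      unfolding vec_mv_def by (auto simp: axis_def intro!: sum.neutral)
    then show ?thesis by simp
  qed
  then show ?thesis
    by (auto simp: vec_eq_iff grade_inv_def wedge_def sum_distrib_left sum_negf[symmetric]
        intro!: sum.cong)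
qed

lemma linear_grade_inv: "linear grade_inv"
  by (auto intro!: linearI simp: grade_inv_def vec_eq_iff algebra_simps)

lemma linear_lcontr_right: "linear (lcontr X)"
  and linear_lcontr_left: "linear (\<lambda>X. lcontr X Y)"
  using bilinear_lcontr by (auto simp: bilinear_def)

lemma grade_inv_axis_empty: "grade_inv (axis {} 1) = axis {} 1"
  by (simp add: grade_inv_def vec_eq_iff axis_def)

lemma grade_inv_grade_inv [simp]: "grade_inv (grade_inv X) = X"
  by (simp add: grade_inv_def vec_eq_iff power_mult_distrib[symmetric] mult.assoc[symmetric])

lemma mv_rev_mv_rev [simp]: "mv_rev (mv_rev X) = X"
  by (simp add: mv_rev_def vec_eq_iff power_mult_distrib[symmetric] mult.assoc[symmetric])

lemma lcontr_vec_empty: "lcontr (vec_mv v) (axis {} 1) = 0"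
proof -
  have "lcontr (vec_mv v) (axis {} 1) \<bullet> Z = 0" for Z
    unfolding inner_vec_mv_lcontr by (simp add: inner_axis' wedge_def) (simp add: vec_mv_def axis_def)
  then show ?thesis by (metis inner_eq_zero_iff)
qed

text \<open>For a product of vectors this is an induction on the list with
  \<open>lcontr_vec_wedge\<close>: each vector passed contributes one sign, which
  \<open>grade_inv\<close> collects. Both sides are linear in \<open>X\<close>, and every basis
  blade is such a product.\<close>

lemma lcontr_vec_wedge_distrib:
  "lcontr (vec_mv v) (X \<curlywedge> Z) = lcontr (vec_mv v) X \<curlywedge> Z + grade_inv X \<curlywedge> lcontr (vec_mv v) Z"
proof -
  have wl: "lcontr (vec_mv v) (wedge_list ws \<curlywedge> Z) =
      lcontr (vec_mv v) (wedge_list ws) \<curlywedge> Z + grade_inv (wedge_list ws) \<curlywedge> lcontr (vec_mv v) Z" for ws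
    by (induction ws)
      (simp_all add: grade_inv_axis_empty wedge_one_left lcontr_vec_empty wedge_bilinear_simps
        wedge_assoc lcontr_vec_wedge grade_inv_vec_wedge bilinear_lsub[OF bilinear_wedge])
  let ?L = "\<lambda>X. lcontr (vec_mv v) (X \<curlywedge> Z)"
  let ?R = "\<lambda>X. lcontr (vec_mv v) X \<curlywedge> Z + grade_inv X \<curlywedge> lcontr (vec_mv v) Z"
  have "linear ?L"
    using linear_compose[OF linear_wedge_left linear_lcontr_right] by (simp add: o_def)
  moreover have "linear ?R"
    using linear_compose_add[OF linear_compose[OF linear_lcontr_right linear_wedge_left]
        linear_compose[OF linear_grade_inv linear_wedge_left]]
    by (simp add: o_def)
  moreover have "?L b = ?R b" if "b \<in> Basis" for b
  proof -
    obtain A where "b = axis A 1" using \<open>b \<in> Basis\<close> by (auto simp: Basis_vec_def)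
    then show ?thesis by (metis wl wedge_list_axis)
  qed
  ultimately have "?L = ?R" by (rule linear_eq_stdbasis)
  then show ?thesis by metis
qed

section \<open>The pseudoscalar and the standard Hodge dual\<close>

lemma vec_wedge_pseudoscalar: "vec_mv v \<curlywedge> axis UNIV 1 = 0"
proof -
  have "axis {i} 1 \<curlywedge> axis UNIV 1 = 0" for i :: 'a by (simp add: wedge_axis)
  then show ?thesis
    by (simp add: vec_mv_def linear_sum[OF linear_wedge_left] wedge_bilinear_simps)
qed

lemma vec_wedge_lcontr_pseudoscalar:
  "vec_mv v \<curlywedge> lcontr (mv_rev X) (axis UNIV 1) =
    - lcontr (mv_rev (lcontr (vec_mv v) (grade_inv X))) (axis UNIV 1)"
proof -
  let ?I = "axis UNIV 1 :: 'a multivector"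
  have "(vec_mv v \<curlywedge> lcontr (mv_rev X) ?I) \<bullet> Z =
      (- lcontr (mv_rev (lcontr (vec_mv v) (grade_inv X))) ?I) \<bullet> Z" for Z
  proof -
    have "(vec_mv v \<curlywedge> lcontr (mv_rev X) ?I) \<bullet> Z = lcontr (mv_rev X) ?I \<bullet> lcontr (vec_mv v) Z"
      by (metis inner_vec_mv_lcontr inner_commute)
    also have "\<dots> = ?I \<bullet> (X \<curlywedge> lcontr (vec_mv v) Z)"
      by (simp add: inner_lcontr)
    \<comment> \<open>The antiderivation law is applied to
      \<open>grade_inv X \<curlywedge> Z\<close>; the second grade involution restores the bare
      \<open>X\<close> in front of the contraction of \<open>Z\<close>.\<close>
    also have "\<dots> = ?I \<bullet> lcontr (vec_mv v) (grade_inv X \<curlywedge> Z) - ?I \<bullet> (lcontr (vec_mv v) (grade_inv X) \<curlywedge> Z)"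
      by (simp add: lcontr_vec_wedge_distrib inner_add)
    \<comment> \<open>By adjointness the contraction returns to the other factor as an exterior
      product of \<open>v\<close> with the pseudoscalar.\<close>
    also have "?I \<bullet> lcontr (vec_mv v) (grade_inv X \<curlywedge> Z) = 0"
      by (metis inner_vec_mv_lcontr inner_commute vec_wedge_pseudoscalar inner_zero_left)
    finally show ?thesis by (simp add: inner_lcontr)
  qed
  then show ?thesis using vector_eq_rdot by blast
qed

lemma linear_std_hodge: "linear (std_hodge \<tau> p)"
  using linear_compose[OF linear_mv_rev linear_lcontr_left] by (simp add: o_def std_hodge_def[abs_def])

text \<open>The dual paired with the blade of \<open>- A\<close> yields, up to the factor
  \<open>s\<close> and a sign, the coefficient of \<open>X\<close> at \<open>A\<close>: only the
  complement of \<open>- A\<close> can complete it to \<open>UNIV\<close>. Hence the kernel is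
  trivial, and \<open>inv\<close> is a genuine left inverse.\<close>

lemma inj_std_hodge:
  assumes "\<tau> p = s *\<^sub>R axis UNIV 1" "s \<noteq> 0"
  shows "inj (std_hodge \<tau> p)"
proof (subst linear_injective_0[OF linear_std_hodge], intro allI impI)
  fix X :: "'a multivector"
  assume 0: "std_hodge \<tau> p X = 0"
  have "X $ A = 0" for A
  proof -
    have e: "B = A" if "- A = - B" for B using that by auto
    have "0 = std_hodge \<tau> p X \<bullet> axis (- A) 1" using 0 by simp
    also have "\<dots> = s * (X \<curlywedge> axis (- A) 1) $ UNIV"
      by (simp add: std_hodge_def inner_lcontr assms(1) inner_axis')
    also have "(X \<curlywedge> axis (- A) 1) $ UNIV =
        (\<Sum>B\<in>Pow UNIV. if B = A then blade_sign A (- A) * X $ A else 0)"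
      unfolding wedge_def vec_lambda_beta
      by (intro sum.cong refl) (use e in \<open>auto simp: axis_def Compl_eq_Diff_UNIV[symmetric]\<close>)
    finally show ?thesis using assms(2) by (simp add: blade_sign_def)
  qed
  then show "X = 0" by (simp add: vec_eq_iff)
qed

section \<open>Exterior extensions and the metric Hodge dual\<close>

lemma ext_map_component_grade:
  assumes "\<And>A B. card A = card B \<Longrightarrow> c A = c B"
  shows "ext_map f (\<chi> A. c A * X $ A) = (\<chi> A. c A * ext_map f X $ A)"
proof -
  \<comment> \<open>The extension preserves grade: the product attached to \<open>A\<close> has
    coefficients only at sets \<open>B\<close> of the same size, where \<open>c A\<close> and
    \<open>c B\<close> agree.\<close>
  have "c A * X $ A * wedge_list (map (\<lambda>i. f (axis i 1)) (sorted_list_of_set A)) $ B =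
      c B * (X $ A * wedge_list (map (\<lambda>i. f (axis i 1)) (sorted_list_of_set A)) $ B)" for A B
  proof (cases "card A = card B")
    case True
    then show ?thesis using assms[OF True] by simp
  next
    case False
    then show ?thesis by (simp add: wedge_list_grade)
  qed
  then show ?thesis
    unfolding ext_map_def vec_eq_iff
    by (simp add: sum_component sum_distrib_left) (intro allI sum.cong refl; simp)
qed

lemma ext_map_grade_inv: "ext_map f (grade_inv X) = grade_inv (ext_map f X)"
  unfolding grade_inv_def by (rule ext_map_component_grade) simp

lemma ext_map_mv_rev: "ext_map f (mv_rev X) = mv_rev (ext_map f X)"
  unfolding mv_rev_def by (rule ext_map_component_grade) simp

lemma ext_map_compose: "linear f \<Longrightarrow> ext_map f (ext_map h X) = ext_map (\<lambda>v. f (h v)) X"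
  by (simp add: ext_map_def[of h] ext_map_def[of "\<lambda>v. f (h v)"] linear_sum[OF linear_ext_map]
      linear_cmul[OF linear_ext_map] ext_map_wedge_list o_def)

lemma ext_map_id: "ext_map (\<lambda>v. v) X = X"
  by (simp add: ext_map_def wedge_list_axis blade_expansion[symmetric])

text \<open>Reversal commutes with the exterior extension and contraction is linear on the left, so
  the metric enters only through a rescaled argument. This reduces the second identity to the
  first.\<close>

lemma metric_hodge_eq:
  "metric_hodge g \<tau> p X =
    std_hodge \<tau> p (sqrt \<bar>endo_det (g p)\<bar> *\<^sub>R ext_map (inv (blinfun_apply (g p))) X)"
  by (simp add: metric_hodge_def std_hodge_def linear_cmul[OF linear_mv_rev]
      linear_cmul[OF linear_lcontr_left] ext_map_mv_rev)

section \<open>The standard volume field as a signed pseudoscalar\<close>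

lemma frame_wedge_eq: "frame_wedge e p = (frame_wedge e p $ UNIV) *\<^sub>R axis UNIV 1"
proof -
  have "frame_wedge e p $ A = 0" if "A \<noteq> UNIV" for A
    unfolding frame_wedge_def
    using that psubset_card_mono[of UNIV A] by (intro wedge_list_grade) (auto simp: psubset_eq)
  then show ?thesis by (auto simp: vec_eq_iff axis_def)
qed

text \<open>The product of the two coordinates is the Gram determinant of the frames against each
  other. Any permutation other than the identity moves some index and so contributes a zero
  factor.\<close>

lemma frame_wedge_reciprocal:
  fixes e e' :: "'n::{finite,linorder} \<Rightarrow> 'm \<Rightarrow> (real, 'n) vec"
  assumes "\<And>\<mu> \<nu>. e \<mu> p \<bullet> e' \<nu> p = (if \<mu> = \<nu> then 1 else 0)"
  shows "frame_wedge e p $ UNIV * frame_wedge e' p $ UNIV = 1"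
proof -
  have "frame_wedge e p \<bullet> frame_wedge e' p =
      (\<Sum>q | q permutes (UNIV :: 'n set). of_int (sign q) * (\<Prod>i\<in>UNIV. e i p \<bullet> e' (q i) p))"
    unfolding frame_wedge_def by (subst inner_wedge_list_permutes) auto
  also have "\<dots> = (\<Sum>q | q permutes (UNIV :: 'n set). if q = id then 1 else 0)"
  proof (intro sum.cong refl)
    fix q :: "'n \<Rightarrow> 'n"
    show "of_int (sign q) * (\<Prod>i\<in>UNIV. e i p \<bullet> e' (q i) p) = (if q = id then 1 else 0)"
    proof (cases "q = id")
      case False
      then obtain i where "i \<noteq> q i" by (metis eq_id_iff)
      then have "(\<Prod>i\<in>UNIV. e i p \<bullet> e' (q i) p) = 0"
        using assms by (intro prod_zero) auto
      with False show ?thesis by simp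
    qed (simp add: assms)
  qed
  also have "\<dots> = 1" by (simp add: permutes_id)
  finally show ?thesis
    by (subst (asm) frame_wedge_eq[of e], subst (asm) frame_wedge_eq[of e'])
      (simp add: inner_axis_axis mult.commute)
qed

text \<open>The square root is the absolute value of the coordinate of
  \<open>frame_wedge e p\<close>; multiplied by the reciprocal coordinate it leaves only the
  sign.\<close>

lemma std_volume_eq:
  fixes e e' :: "'n::{finite,linorder} \<Rightarrow> 'm \<Rightarrow> (real, 'n) vec"
  assumes "\<And>\<mu> \<nu>. e \<mu> p \<bullet> e' \<nu> p = (if \<mu> = \<nu> then 1 else 0)"
  shows "std_volume e e' p = sgn (frame_wedge e p $ UNIV) *\<^sub>R axis UNIV 1"
proof -
  let ?c = "frame_wedge e p $ UNIV" and ?c' = "frame_wedge e' p $ UNIV"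
  have "frame_wedge e p \<bullet> frame_wedge e p = ?c * ?c"
    by (subst (1 2) frame_wedge_eq) (simp add: inner_axis_axis)
  then have "std_volume e e' p = (\<bar>?c\<bar> * ?c') *\<^sub>R axis UNIV 1"
    unfolding std_volume_def by (subst frame_wedge_eq[of e']) simp
  also have "\<bar>?c\<bar> * ?c' = sgn ?c"
    using frame_wedge_reciprocal[of e p e', OF assms]
    by (metis abs_sgn mult.assoc mult.commute mult_1)
  finally show ?thesis .
qed

section \<open>Coordinate curves and derivatives along them\<close>

definition coord_curve :: "'m set \<Rightarrow> ('m \<Rightarrow> real ^ 'n) \<Rightarrow> 'n \<Rightarrow> 'm \<Rightarrow> real \<Rightarrow> 'm" where
  "coord_curve V \<phi> \<mu> p t = inv_into V \<phi> (\<phi> p + t *\<^sub>R axis \<mu> 1)"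

lemma local_chart_inj_on:
  assumes "local_chart M V \<phi>"
  shows "inj_on \<phi> V"
proof -
  have "topspace (subtopology M V) = V"
    using assms openin_subset[of M V] by (auto simp: local_chart_def)
  then show ?thesis
    using assms homeomorphic_imp_injective_map unfolding local_chart_def by metis
qed

lemma coord_curve_0: "local_chart M V \<phi> \<Longrightarrow> p \<in> V \<Longrightarrow> coord_curve V \<phi> \<mu> p 0 = p"
  by (simp add: coord_curve_def local_chart_inj_on)

lemma local_chart_open_image:
  assumes "local_chart M V \<phi>" "openin M U" "U \<subseteq> V"
  shows "open (\<phi> ` U)"
proof -
  have "openin (subtopology M V) U"
    using assms by (auto simp: openin_subtopology)
  then have "openin (top_of_set (\<phi> ` V)) (\<phi> ` U)"
    using assms(1) homeomorphic_imp_open_map unfolding local_chart_def open_map_def by blast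
  then show ?thesis
    using assms(1) by (auto simp: local_chart_def openin_open_eq)
qed

text \<open>The chart image of \<open>U\<close> is open, so the coordinate line stays in it for
  small \<open>t\<close>. Outside the image of the chart domain \<open>inv_into\<close> gives
  arbitrary values, which is why facts about the curve are stated only near 0.\<close>

lemma eventually_coord_curve_mem:
  assumes "local_chart M V \<phi>" "openin M U" "U \<subseteq> V" "p \<in> U"
  shows "\<forall>\<^sub>F t in nhds 0. coord_curve V \<phi> \<mu> p t \<in> U"
proof -
  have "((\<lambda>t. \<phi> p + t *\<^sub>R axis \<mu> 1) \<longlongrightarrow> \<phi> p + 0 *\<^sub>R axis \<mu> 1) (nhds (0::real))"
    by (intro tendsto_intros filterlim_ident)
  then have "\<forall>\<^sub>F t in nhds 0. \<phi> p + t *\<^sub>R axis \<mu> 1 \<in> \<phi> ` U"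
    by (rule topological_tendstoD) (use assms local_chart_open_image[OF assms(1-3)] in auto)
  then show ?thesis
  proof (rule eventually_mono)
    fix t assume "\<phi> p + t *\<^sub>R axis \<mu> 1 \<in> \<phi> ` U"
    then obtain q where "q \<in> U" "\<phi> p + t *\<^sub>R axis \<mu> 1 = \<phi> q" by blast
    then show "coord_curve V \<phi> \<mu> p t \<in> U"
      using assms local_chart_inj_on[OF assms(1)] by (auto simp: coord_curve_def)
  qed
qed

lemma smooth_field_differentiable_coord_curve:
  assumes "smooth_chart M \<A> V \<phi>" "f \<in> smooth_fields M \<A> U" "p \<in> U" "p \<in> V"
  shows "(\<lambda>t. f (coord_curve V \<phi> \<mu> p t)) differentiable (at 0)"
proof -
  let ?l = "\<lambda>t::real. \<phi> p + t *\<^sub>R axis \<mu> 1"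
  have "Ck_on (Suc 0) (\<phi> ` (U \<inter> V)) (f \<circ> inv_into V \<phi>)"
    using assms(1,2) unfolding smooth_fields_def smooth_on_def by blast
  then have "(f \<circ> inv_into V \<phi>) differentiable (at (?l 0))"
    using assms(3,4) by auto
  moreover have "?l differentiable (at 0)"
    by (intro derivative_intros)
  ultimately have "((f \<circ> inv_into V \<phi>) \<circ> ?l) differentiable (at 0)"
    by (rule differentiable_chain_at[rotated])
  then show ?thesis by (simp add: o_def coord_curve_def)
qed

text \<open>The agreement of \<open>F\<close> with \<open>L\<close> applied to \<open>Y\<close> is
  required only near the start of the curve. This permits a fixed \<open>L\<close>, such as the
  Hodge operator at \<open>p\<close>, for an operator that is merely locally constant.\<close>

lemma coord_deriv_linear:
  fixes Y :: "'m \<Rightarrow> 'b::euclidean_space" and F :: "'m \<Rightarrow> 'c::real_normed_vector"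
  assumes ev: "\<forall>\<^sub>F t in nhds 0. F (coord_curve V \<phi> \<mu> p t) = L (Y (coord_curve V \<phi> \<mu> p t))"
    and L: "linear L"
    and Y: "(\<lambda>t. Y (coord_curve V \<phi> \<mu> p t)) differentiable (at 0)"
  shows "coord_deriv V \<phi> \<mu> F p = L (coord_deriv V \<phi> \<mu> Y p)"
proof -
  let ?c = "coord_curve V \<phi> \<mu> p"
  have "((\<lambda>t. Y (?c t)) has_vector_derivative coord_deriv V \<phi> \<mu> Y p) (at 0)"
    using Y unfolding coord_deriv_def coord_curve_def by (simp add: vector_derivative_works)
  then have "((\<lambda>t. L (Y (?c t))) has_vector_derivative L (coord_deriv V \<phi> \<mu> Y p)) (at 0)"
    by (rule bounded_linear.has_vector_derivative[OF linear_conv_bounded_linear[THEN iffD1, OF L]])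
  then have "vector_derivative (\<lambda>t. L (Y (?c t))) (at 0) = L (coord_deriv V \<phi> \<mu> Y p)"
    by (rule vector_derivative_at)
  moreover have "vector_derivative (\<lambda>t. F (?c t)) (at 0) = vector_derivative (\<lambda>t. L (Y (?c t))) (at 0)"
    by (intro vector_derivative_cong_eq) (use ev in \<open>auto\<close>)
  ultimately show ?thesis by (simp add: coord_deriv_def coord_curve_def)
qed

text \<open>Local constancy of \<open>\<tau>\<close> lets the Hodge operator commute with each
  coordinate derivative, after which the pseudoscalar identity applies termwise. Leaving
  \<open>Y\<close> general serves both \<open>X\<close> and the rescaled field of the metric
  dual.\<close>

lemma deriv_wedge_std_hodge:
  fixes Y :: "'m \<Rightarrow> 'n::{finite,linorder} multivector"
  assumes tau: "\<tau> p = s *\<^sub>R axis UNIV 1"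
    and ev: "\<And>\<mu>. \<forall>\<^sub>F t in nhds 0. \<tau> (coord_curve V \<phi> \<mu> p t) = \<tau> p"
    and Y: "\<And>\<mu>. (\<lambda>t. Y (coord_curve V \<phi> \<mu> p t)) differentiable (at 0)"
  shows "deriv_wedge V \<phi> (\<lambda>q. std_hodge \<tau> q (Y q)) p =
    std_hodge \<tau> p (- deriv_lcontr V \<phi> (\<lambda>q. grade_inv (Y q)) p)"
proof -
  have 1: "coord_deriv V \<phi> \<mu> (\<lambda>q. std_hodge \<tau> q (Y q)) p = std_hodge \<tau> p (coord_deriv V \<phi> \<mu> Y p)" for \<mu>
    by (intro coord_deriv_linear linear_std_hodge Y eventually_mono[OF ev[of \<mu>]]) (simp add: std_hodge_def)
  have 2: "coord_deriv V \<phi> \<mu> (\<lambda>q. grade_inv (Y q)) p = grade_inv (coord_deriv V \<phi> \<mu> Y p)" for \<mu>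
    by (intro coord_deriv_linear linear_grade_inv Y) simp
  have 3: "vec_mv v \<curlywedge> std_hodge \<tau> p X = std_hodge \<tau> p (- lcontr (vec_mv v) (grade_inv X))" for v X
    using vec_wedge_lcontr_pseudoscalar[of v X]
    by (simp add: linear_neg[OF linear_std_hodge])
      (simp add: std_hodge_def tau linear_cmul[OF linear_lcontr_right] wedge_bilinear_simps)
  show ?thesis
    unfolding deriv_wedge_def deriv_lcontr_def 1 2 3
    by (simp add: linear_neg[OF linear_std_hodge] linear_sum[OF linear_std_hodge] sum_negf)
qed

section \<open>Differentiability of determinants, inverses and exterior extensions\<close>

lemma differentiable_bilinear:
  fixes h :: "'a::euclidean_space \<Rightarrow> 'b::euclidean_space \<Rightarrow> 'c::real_normed_vector"
  assumes "bilinear h" "f differentiable (at x within S)" "k differentiable (at x within S)"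
  shows "(\<lambda>t. h (f t) (k t)) differentiable (at x within S)"
  using assms bounded_bilinear.FDERIV unfolding bilinear_conv_bounded_bilinear differentiable_def by blast

lemma differentiable_linear:
  fixes L :: "'a::euclidean_space \<Rightarrow> 'b::real_normed_vector"
  assumes "linear L" "f differentiable (at x within S)"
  shows "(\<lambda>t. L (f t)) differentiable (at x within S)"
  using assms bounded_linear.has_derivative
  unfolding linear_conv_bounded_linear differentiable_def by blast

lemma differentiable_wedge_list:
  fixes u :: "'i \<Rightarrow> 'a::real_normed_vector \<Rightarrow> (real, 'n::{finite,linorder}) vec"
  assumes "\<And>i. (\<lambda>t. u i t) differentiable (at x within S)"
  shows "(\<lambda>t. wedge_list (map (\<lambda>i. u i t) is)) differentiable (at x within S)"
  by (induction "is")
    (auto intro!: differentiable_bilinear[OF bilinear_wedge] differentiable_linear[OF linear_vec_mv] assms)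

lemma differentiable_vec_nth:
  fixes f :: "'a::real_normed_vector \<Rightarrow> (real, 'n::finite) vec"
  shows "f differentiable (at x within S) \<Longrightarrow> (\<lambda>t. f t $ i) differentiable (at x within S)"
  using bounded_linear.has_derivative[OF bounded_linear_vec_nth] unfolding differentiable_def by blast

lemma differentiable_vec_lambda:
  fixes f :: "'a::real_normed_vector \<Rightarrow> (real, 'n::finite) vec"
  assumes "\<And>i. (\<lambda>t. f t $ i) differentiable (at x within S)"
  shows "f differentiable (at x within S)"
proof -
  have "(\<lambda>t. \<Sum>i\<in>UNIV. f t $ i *\<^sub>R axis i (1::real)) differentiable (at x within S)"
    by (intro differentiable_sum ballI differentiable_scaleR assms differentiable_const finite)
  moreover have "(\<Sum>i\<in>UNIV. f t $ i *\<^sub>R axis i 1) = f t" for t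
    using basis_expansion[of "f t"] by (simp add: scalar_mult_eq_scaleR)
  ultimately show ?thesis by simp
qed

lemma differentiable_det:
  fixes B :: "'a::real_normed_vector \<Rightarrow> real ^ 'n ^ 'n"
  assumes "\<And>i j. (\<lambda>t. B t $ i $ j) differentiable (at x within S)"
  shows "(\<lambda>t. det (B t)) differentiable (at x within S)"
proof -
  have "(\<lambda>t. \<Prod>i\<in>I. B t $ i $ q i) differentiable (at x within S)" if "finite I" for q and I :: "'n set"
    using that by (induction I) (auto intro!: differentiable_mult assms)
  then show ?thesis
    unfolding det_def by (intro differentiable_sum ballI differentiable_mult differentiable_const) (auto simp: finite_permutations)
qed

lemma bij_blinfun_endo_det:
  fixes T :: "(real ^ 'n) \<Rightarrow>\<^sub>L (real ^ 'n)"
  assumes "endo_det T \<noteq> 0"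
  shows "bij (blinfun_apply T)"
proof -
  have "linear (blinfun_apply T)" by (simp add: bounded_linear.linear[OF blinfun.bounded_linear_right])
  then show ?thesis
    using assms unfolding endo_det_def bij_def
    by (simp add: det_nz_iff_inj linear_injective_imp_surjective)
qed

text \<open>Writing the components of the inverse as quotients of determinants makes their
  differentiability visible.\<close>

lemma inv_blinfun_cramer:
  fixes T :: "(real ^ 'n) \<Rightarrow>\<^sub>L (real ^ 'n)"
  assumes "endo_det T \<noteq> 0"
  shows "inv (blinfun_apply T) v $ k =
    det (\<chi> i j. if j = k then v $ i else T (axis j 1) $ i) / endo_det T"
proof -
  have "matrix (blinfun_apply T) *v inv (blinfun_apply T) v = v"
    using bij_blinfun_endo_det[OF assms]
    by (simp add: matrix_vector_mul(2)[OF bounded_linear.linear[OF blinfun.bounded_linear_right]] bij_is_surj surj_f_inv_f)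
  then have "inv (blinfun_apply T) v =
      (\<chi> k. det (\<chi> i j. if j = k then v $ i else matrix (blinfun_apply T) $ i $ j) /
        det (matrix (blinfun_apply T)))"
    using cramer assms unfolding endo_det_def by blast
  then show ?thesis by (simp add: matrix_def endo_det_def cong: if_cong)
qed

lemma differentiable_endo_det:
  fixes T :: "'a::real_normed_vector \<Rightarrow> (real ^ 'n) \<Rightarrow>\<^sub>L (real ^ 'n)"
  assumes "T differentiable (at x within S)"
  shows "(\<lambda>t. endo_det (T t)) differentiable (at x within S)"
proof -
  have "(\<lambda>t. blinfun_apply (T t) v $ i) differentiable (at x within S)" for v i
    using assms bounded_linear.has_derivative[OF blinfun.bounded_linear_left]
    by (intro differentiable_vec_nth) (unfold differentiable_def, blast)
  then show ?thesis
    unfolding endo_det_def by (intro differentiable_det) (simp add: matrix_def)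
qed

text \<open>Cramer's rule is available only where the determinant is nonzero, so the derivative of
  the quotient is transferred along a neighbourhood of \<open>x\<close>. Since \<open>nhds x\<close>
  includes \<open>x\<close>, the required agreement at the point itself follows too.\<close>

lemma differentiable_inv_blinfun:
  fixes T :: "'a::real_normed_vector \<Rightarrow> (real ^ 'n) \<Rightarrow>\<^sub>L (real ^ 'n)"
  assumes T: "T differentiable (at x)" and ev: "\<forall>\<^sub>F t in nhds x. endo_det (T t) \<noteq> 0"
  shows "(\<lambda>t. inv (blinfun_apply (T t)) v) differentiable (at x)"
proof (rule differentiable_vec_lambda)
  fix k
  let ?q = "\<lambda>t. det (\<chi> i j. if j = k then v $ i else T t (axis j 1) $ i) / endo_det (T t)"
  have "(\<lambda>t. blinfun_apply (T t) w $ i) differentiable (at x)" for w i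
    using T bounded_linear.has_derivative[OF blinfun.bounded_linear_left]
    by (intro differentiable_vec_nth) (unfold differentiable_def, blast)
  then have "(\<lambda>t. if j = k then v $ i else T t (axis j 1) $ i) differentiable (at x)" for i j
    by (cases "j = k") simp_all
  then have "?q differentiable (at x)"
    by (intro differentiable_divide differentiable_det differentiable_endo_det T)
      (simp_all add: eventually_nhds_x_imp_x[OF ev])
  then obtain D where D: "(?q has_derivative D) (at x)"
    unfolding differentiable_def ..
  have eq: "\<forall>\<^sub>F t in nhds x. ?q t = inv (blinfun_apply (T t)) v $ k"
    using ev by (rule eventually_mono) (simp add: inv_blinfun_cramer)
  have "((\<lambda>t. inv (blinfun_apply (T t)) v $ k) has_derivative D) (at x)"
    by (rule has_derivative_transform_eventually[OF D])
      (use eq eventually_nhds_x_imp_x[OF eq] in \<open>auto simp: eventually_at_filter elim: eventually_mono\<close>)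
  then show "(\<lambda>t. inv (blinfun_apply (T t)) v $ k) differentiable (at x)"
    by (rule differentiableI)
qed

lemma differentiable_ext_map:
  fixes f :: "'a::real_normed_vector \<Rightarrow> (real, 'n::{finite,linorder}) vec \<Rightarrow> (real, 'n) vec"
  assumes "\<And>v. (\<lambda>t. f t v) differentiable (at x within S)" "Z differentiable (at x within S)"
  shows "(\<lambda>t. ext_map (f t) (Z t)) differentiable (at x within S)"
  unfolding ext_map_def
  by (intro differentiable_sum ballI differentiable_scaleR differentiable_vec_nth differentiable_wedge_list
      assms finite)

text \<open>Writing the absolute value as \<open>sqrt (d t * d t)\<close> avoids a case split on the
  sign; both roots are then taken at positive values.\<close>

lemma differentiable_sqrt_abs:
  fixes d :: "real \<Rightarrow> real"
  assumes "d differentiable (at x)" "d x \<noteq> 0"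
  shows "(\<lambda>t. sqrt \<bar>d t\<bar>) differentiable (at x)"
proof -
  have sq: "(\<lambda>t. sqrt (f t)) differentiable (at x)" if "f differentiable (at x)" "f x > 0" for f
    using that has_derivative_real_sqrt unfolding differentiable_def by blast
  have "(\<lambda>t. sqrt (sqrt (d t * d t))) differentiable (at x)"
    using assms by (intro sq differentiable_mult) (auto simp: zero_less_mult_iff)
  then show ?thesis by simp
qed

section \<open>The two Hodge identities at a point of \<open>U\<close>\<close>

theorem mainTheorem15:
  fixes M :: "'m topology"
    and \<A> :: "('m set \<times> ('m \<Rightarrow> (real, 'n::{finite,linorder}) vec)) set"
    and U\<^sub>o U :: "'m set"
    and \<phi>\<^sub>o :: "'m \<Rightarrow> (real, 'n) vec"
    and g :: "'m \<Rightarrow> (real, 'n) vec \<Rightarrow>\<^sub>L (real, 'n) vec"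
    and e e' :: "'n \<Rightarrow> 'm \<Rightarrow> (real, 'n) vec"
    and \<tau> X :: "'m \<Rightarrow> 'n multivector"
  assumes "smooth_manifold M \<A>"
    and "smooth_chart M \<A> U\<^sub>o \<phi>\<^sub>o"
    and "openin M U" and "U \<subseteq> U\<^sub>o"
    and "metric_structure M \<A> U g"
    and "reciprocal_frame_fields M \<A> U e e'"
    and "\<tau> = std_volume e e'"
    and "X \<in> smooth_fields M \<A> U"
  shows "\<forall>p\<in>U.
      inv (std_hodge \<tau> p) (deriv_wedge U\<^sub>o \<phi>\<^sub>o (\<lambda>q. std_hodge \<tau> q (X q)) p) =
      - deriv_lcontr U\<^sub>o \<phi>\<^sub>o (\<lambda>q. grade_inv (X q)) p \<and>
      inv (metric_hodge g \<tau> p) (deriv_wedge U\<^sub>o \<phi>\<^sub>o (\<lambda>q. metric_hodge g \<tau> q (X q)) p) =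
      - ((1 / sqrt \<bar>endo_det (g p)\<bar>) *\<^sub>R
          ext_map (blinfun_apply (g p))
            (deriv_lcontr U\<^sub>o \<phi>\<^sub>o
              (\<lambda>q. sqrt \<bar>endo_det (g q)\<bar> *\<^sub>R ext_map (inv (blinfun_apply (g q))) (grade_inv (X q))) p))"
proof (intro ballI)
  fix p assume p: "p \<in> U"
  let ?c = "\<lambda>\<mu>. coord_curve U\<^sub>o \<phi>\<^sub>o \<mu> p"
  let ?s = "\<lambda>q. sqrt \<bar>endo_det (g q)\<bar>"
  let ?h = "\<lambda>q. ext_map (inv (blinfun_apply (g q)))"
  let ?Y = "\<lambda>q. ?s q *\<^sub>R ?h q (X q)"
  let ?d = "\<lambda>q. frame_wedge e q $ UNIV"
  have chart: "local_chart M U\<^sub>o \<phi>\<^sub>o"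
    using assms(2) by (simp add: smooth_chart_def)
  have pUo: "p \<in> U\<^sub>o" using p assms(4) by blast
  have c0: "?c \<mu> 0 = p" for \<mu> by (rule coord_curve_0[OF chart pUo])
  have cU: "\<forall>\<^sub>F t in nhds 0. ?c \<mu> t \<in> U" for \<mu>
    by (rule eventually_coord_curve_mem[OF chart assms(3,4) p])
  note diff = smooth_field_differentiable_coord_curve[OF assms(2) _ p pUo]
  have rec: "e \<mu> q \<bullet> e' \<nu> q = (if \<mu> = \<nu> then 1 else 0)" if "q \<in> U" for q \<mu> \<nu>
    using assms(6) that by (auto simp: reciprocal_frame_fields_def)
  have tau: "\<tau> q = sgn (?d q) *\<^sub>R axis UNIV 1" if "q \<in> U" for q
    unfolding assms(7) by (rule std_volume_eq) (rule rec[OF that])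
  have d0: "?d p \<noteq> 0"
    using frame_wedge_reciprocal[of e p e', OF rec[OF p]] by auto
  \<comment> \<open>\<open>\<tau>\<close> depends on the frame only through the sign of
    \<open>?d\<close>, which is continuous along the curve and nonzero at its start.\<close>
  have tau_const: "\<forall>\<^sub>F t in nhds 0. \<tau> (?c \<mu> t) = \<tau> p" for \<mu>
  proof -
    have "e i \<in> smooth_fields M \<A> U" for i
      using assms(6) by (simp add: reciprocal_frame_fields_def frame_field_def)
    then have "(\<lambda>t. ?d (?c \<mu> t)) differentiable (at 0)"
      unfolding frame_wedge_def by (intro differentiable_vec_nth differentiable_wedge_list diff)
    then have "((\<lambda>t. ?d (?c \<mu> t)) \<longlongrightarrow> ?d p) (nhds 0)"
      using differentiable_imp_continuous_within[of "\<lambda>t. ?d (?c \<mu> t)" 0 UNIV]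
      by (simp add: isCont_def tendsto_nhds_iff c0)
    note lim = order_tendstoD[OF this]
    have "\<forall>\<^sub>F t in nhds 0. sgn (?d (?c \<mu> t)) = sgn (?d p)"
    proof (cases "?d p > 0")
      case True
      then show ?thesis using lim(1)[OF True] by (simp add: eventually_mono)
    next
      case False
      then have "?d p < 0" using d0 by simp
      then show ?thesis using lim(2)[OF \<open>?d p < 0\<close>] by (simp add: eventually_mono)
    qed
    then show ?thesis
      using cU[of \<mu>] by eventually_elim (simp add: tau p)
  qed
  have g0: "endo_det (g q) \<noteq> 0" if "q \<in> U" for q
    using assms(5) that by (auto simp: metric_structure_def)
  have gd: "(\<lambda>t. g (?c \<mu> t)) differentiable (at 0)" for \<mu>
    using assms(5) by (intro diff) (simp add: metric_structure_def)
  have Xd: "(\<lambda>t. X (?c \<mu> t)) differentiable (at 0)" for \<mu>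
    by (rule diff) fact
  \<comment> \<open>\<open>cU\<close> keeps the curve in \<open>U\<close> near 0, which supplies the
    nonzero determinant needed for the inverse; for the square root its value at \<open>p\<close> is
    enough.\<close>
  have Yd: "(\<lambda>t. ?Y (?c \<mu> t)) differentiable (at 0)" for \<mu>
    by (intro differentiable_scaleR differentiable_sqrt_abs differentiable_endo_det
        differentiable_ext_map differentiable_inv_blinfun gd Xd)
      (use cU[of \<mu>] in \<open>auto simp: c0 p g0 elim: eventually_mono\<close>)
  note hodge = deriv_wedge_std_hodge[where \<tau> = \<tau> and p = p and V = U\<^sub>o and \<phi> = \<phi>\<^sub>o, OF tau[OF p] tau_const]
  have inj: "inj (std_hodge \<tau> p)"
    using d0 by (intro inj_std_hodge[where s = "sgn (?d p)"] tau p) (simp add: sgn_zero_iff)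
  have bij: "bij (blinfun_apply (g p))" by (rule bij_blinfun_endo_det[OF g0[OF p]])
  have gl: "linear (blinfun_apply (g p))" by (rule bounded_linear.linear[OF blinfun.bounded_linear_right])
  have gil: "linear (inv (blinfun_apply (g p)))"
    using gl bij by (simp add: inj_linear_imp_inv_linear bij_is_inj)
  have gh: "ext_map (blinfun_apply (g p)) (?h p Z) = Z" for Z
    using bij by (simp add: ext_map_compose[OF gl] bij_is_surj surj_f_inv_f ext_map_id)
  have hg: "?h p (ext_map (blinfun_apply (g p)) Z) = Z" for Z
    using bij by (simp add: ext_map_compose[OF gil] bij_is_inj ext_map_id)
  have s0: "?s p \<noteq> 0" using g0[OF p] by simp
  \<comment> \<open>The metric operator is the injective standard one after scaling by
    \<open>?s p\<close> and applying \<open>?h p\<close>, and \<open>gh\<close> undoes the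
    latter.\<close>
  have injm: "inj (metric_hodge g \<tau> p)"
  proof (rule injI)
    fix Z Z' assume "metric_hodge g \<tau> p Z = metric_hodge g \<tau> p Z'"
    then have "?h p Z = ?h p Z'"
      using s0 injD[OF inj] by (metis metric_hodge_eq scaleR_cancel_left)
    then show "Z = Z'" using gh by metis
  qed
  let ?W = "deriv_lcontr U\<^sub>o \<phi>\<^sub>o (\<lambda>q. ?s q *\<^sub>R ?h q (grade_inv (X q))) p"
  \<comment> \<open>The first identity for \<open>?Y\<close> produces \<open>grade_inv\<close> of
    the rescaled field; it moves inward past the scalar and the extension to give
    \<open>?W\<close>.\<close>
  have "deriv_wedge U\<^sub>o \<phi>\<^sub>o (\<lambda>q. metric_hodge g \<tau> q (X q)) p = std_hodge \<tau> p (- ?W)"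
    unfolding metric_hodge_eq
    by (subst hodge[OF Yd]) (simp add: linear_cmul[OF linear_grade_inv] ext_map_grade_inv)
  \<comment> \<open>The claimed right-hand side is chosen so that \<open>?s p\<close> and
    \<open>?h p\<close> cancel its outer factors; \<open>metric_hodge_eq\<close> then reads the
    standard dual as a metric one.\<close>
  also have "- ?W = ?s p *\<^sub>R ?h p (- ((1 / ?s p) *\<^sub>R ext_map (blinfun_apply (g p)) ?W))"
    using s0 by (simp add: linear_neg[OF linear_ext_map] linear_cmul[OF linear_ext_map] hg)
  finally have "deriv_wedge U\<^sub>o \<phi>\<^sub>o (\<lambda>q. metric_hodge g \<tau> q (X q)) p =
      metric_hodge g \<tau> p (- ((1 / ?s p) *\<^sub>R ext_map (blinfun_apply (g p)) ?W))"
    by (simp add: metric_hodge_eq)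
  then show "inv (std_hodge \<tau> p) (deriv_wedge U\<^sub>o \<phi>\<^sub>o (\<lambda>q. std_hodge \<tau> q (X q)) p) =
      - deriv_lcontr U\<^sub>o \<phi>\<^sub>o (\<lambda>q. grade_inv (X q)) p \<and>
      inv (metric_hodge g \<tau> p) (deriv_wedge U\<^sub>o \<phi>\<^sub>o (\<lambda>q. metric_hodge g \<tau> q (X q)) p) =
      - ((1 / ?s p) *\<^sub>R ext_map (blinfun_apply (g p)) ?W)"
    by (simp only: hodge[OF Xd] inv_f_f[OF inj] inv_f_f[OF injm] simp_thms)
qed

end
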